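(* Consider the Gaussian sequence model with $n\to\infty$, $s_n\to\infty$, $n/s_n\to\infty$. Let $b$ be a fixed real, $a_b=\sqrt{2\log(n/s_n)}+b$ and $$\Theta_b=\{\theta\in\mathbb{R}^n:\ |S_\theta|=s_n,\ |\theta_i|\ge a_b\ \text{for all } i\in S_\theta\}.$$ Let $B=(B_n)_n$ be a sequence with $B_n^2\le e^{(\log(n/s_n))^{1/4}}$ and $\varliminf_n B_n>1$, and let $\mathcal S_B(\Theta_b)$ be the set of procedures that are sparsity-preserving over $\Theta_b$ up to the multiplicative factor $B$. Then $$\inf_{\varphi\in\mathcal S_B(\Theta_b)}\ \sup_{\theta\in\Theta_b}\ \mathrm{FNR}(\theta,\varphi)=\overline\Phi(b)+o(1).$$ The result continues to hold if $b=b_n\to+\infty$ or $b=b_n\to-\infty$.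
   Context: Model: for each $n$, one observes $X_i=\theta_i+\varepsilon_i$, $1\le i\le n$, $\varepsilon_i$ i.i.d. $\mathcal N(0,1)$, $\theta\in\mathbb R^n$ deterministic; $P_\theta,E_\theta$ denote the law of $X$ and its expectation; $S_\theta=\{i:\theta_i\ne0\}$; $(s_n)$ integers. $\overline\Phi(x)=P(\mathcal N(0,1)>x)$, $\overline\Phi(+\infty)=0$, $\overline\Phi(-\infty)=1$. A multiple testing procedure is (a sequence in $n$ of) measurable maps $\varphi:\mathbb R^n\to\{0,1\}^n$. $\mathrm{FNR}(\theta,\varphi)=E_\theta\left[\frac{\sum_i\mathbf 1\{\theta_i\ne0\}(1-\varphi_i(X))}{1\vee|S_\theta|}\right]$. A sequence of procedures $\varphi$ is sparsity-preserving over $\Theta=(\Theta_n)_n$ up to a multiplicative factor $A=(A_n)_n$ if, as $n\to\infty$, $\sup_{\theta\in\Theta_n}P_\theta\left[\sum_{i=1}^n\varphi_i(X)>A_ns_n\right]=o(1)$; the set of all such sequences is $\mathcal S_A(\Theta)$. Convention: since $\mathcal S_B$ is a class of sequences of procedures, "$\inf_{\varphi\in\mathcal S_B}\sup_\theta \mathrm{FNR}(\theta,\varphi)=L_n+o(1)$" means: every sequence $\varphi\in\mathcal S_B$ satisfies $\sup_\theta\mathrm{FNR}(\theta,\varphi)\ge L_n-o(1)$, and some sequence in $\mathcal S_B$ satisfies $\sup_\theta\mathrm{FNR}(\theta,\varphi)\le L_n+o(1)$. *)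

theory Defs
  imports "HOL-Probability.Probability" "HOL-Library.Landau_Symbols"
begin

text \<open>
  Vectors of \<open>\<real>\<^sup>n\<close> are extensional functions on \<open>{1..n}\<close>, i.e. points of \<open>space (obs_space n)\<close>.
\<close>

definition obs_space :: "nat \<Rightarrow> (nat \<Rightarrow> real) measure" where
  "obs_space n = (\<Pi>\<^sub>M i\<in>{1..n}. borel)"

definition noise :: "nat \<Rightarrow> (nat \<Rightarrow> real) measure" where
  "noise n = (\<Pi>\<^sub>M i\<in>{1..n}. density lborel std_normal_density)"

definition obs_law :: "nat \<Rightarrow> (nat \<Rightarrow> real) \<Rightarrow> (nat \<Rightarrow> real) measure" where
  "obs_law n \<theta> = distr (noise n) (obs_space n) (\<lambda>\<epsilon>. \<lambda>i\<in>{1..n}. \<theta> i + \<epsilon> i)"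

definition normal_tail :: "real \<Rightarrow> real" where
  "normal_tail x = measure (density lborel std_normal_density) {x<..}"

definition supp :: "nat \<Rightarrow> (nat \<Rightarrow> real) \<Rightarrow> nat set" where
  "supp n \<theta> = {i \<in> {1..n}. \<theta> i \<noteq> 0}"

definition procedures :: "nat \<Rightarrow> ((nat \<Rightarrow> real) \<Rightarrow> nat \<Rightarrow> nat) set" where
  "procedures n = measurable (obs_space n) (\<Pi>\<^sub>M i\<in>{1..n}. count_space {0, 1})"

definition FNR :: "nat \<Rightarrow> (nat \<Rightarrow> real) \<Rightarrow> ((nat \<Rightarrow> real) \<Rightarrow> nat \<Rightarrow> nat) \<Rightarrow> real" where
  "FNR n \<theta> \<phi> =
     (\<integral>X. (\<Sum>i=1..n. of_bool (\<theta> i \<noteq> 0) * (1 - real (\<phi> X i))) / max 1 (real (card (supp n \<theta>)))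
        \<partial>obs_law n \<theta>)"

text \<open>
  The suprema below are taken in \<open>real\<close>; they are genuine suprema of values in \<open>[0, 1]\<close>
  whenever the parameter set is nonempty.
\<close>

definition sparsity_preserving ::
  "(nat \<Rightarrow> nat) \<Rightarrow> (nat \<Rightarrow> real) \<Rightarrow> (nat \<Rightarrow> (nat \<Rightarrow> real) set)
     \<Rightarrow> (nat \<Rightarrow> (nat \<Rightarrow> real) \<Rightarrow> nat \<Rightarrow> nat) set" where
  "sparsity_preserving s A \<Theta> =
     {\<phi>. (\<forall>n. \<phi> n \<in> procedures n) \<and>
          (\<lambda>n. SUP \<theta>\<in>\<Theta> n.
             \<P>(X in obs_law n \<theta>. real (\<Sum>i=1..n. \<phi> n X i) > A n * real (s n))) \<in> o(\<lambda>_. 1)}"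

definition signal_class :: "(nat \<Rightarrow> nat) \<Rightarrow> (nat \<Rightarrow> real) \<Rightarrow> nat \<Rightarrow> (nat \<Rightarrow> real) set" where
  "signal_class s b n =
     {\<theta> \<in> {1..n} \<rightarrow>\<^sub>E UNIV. card (supp n \<theta>) = s n \<and>
        (\<forall>i\<in>supp n \<theta>. \<bar>\<theta> i\<bar> \<ge> sqrt (2 * ln (real n / real (s n))) + b n)}"

text \<open>
  For a class \<open>C\<close> of sequences of procedures, the meaning of
  ``the infimum over \<open>\<phi> \<in> C\<close> of \<open>R\<^sub>n(\<phi>\<^sub>n)\<close> equals \<open>L\<^sub>n + o(1)\<close>''.
\<close>

definition inf_eq_up_to_o1 ::
  "(nat \<Rightarrow> 'p) set \<Rightarrow> (nat \<Rightarrow> 'p \<Rightarrow> real) \<Rightarrow> (nat \<Rightarrow> real) \<Rightarrow> bool" where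
  "inf_eq_up_to_o1 C R L \<longleftrightarrow>
     (\<forall>\<phi>\<in>C. \<exists>r. r \<in> o(\<lambda>_. 1) \<and> (\<forall>\<^sub>F n in sequentially. R n (\<phi> n) \<ge> L n - r n)) \<and>
     (\<exists>\<phi>\<in>C. \<exists>r. r \<in> o(\<lambda>_. 1) \<and> (\<forall>\<^sub>F n in sequentially. R n (\<phi> n) \<le> L n + r n))"

end

theory Submission
  imports Defs "HOL-Real_Asymp.Real_Asymp"
begin

text \<open>
  Upper bound: the test selecting the coordinates with \<open>\<bar>X i\<bar> > r\<close>, \<open>r = sqrt (2 * ln (n / s))\<close>, misses a given
  signal with probability at most \<open>normal_tail b\<close>, and the expected number of its false selections is at
  most \<open>2 * n * normal_tail r \<le> 2 * s / r = o(s)\<close>, so it selects at most \<open>B * s\<close> coordinates with high probability.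

  Lower bound: give all signals the value \<open>a = r + c\<close> with \<open>c \<ge> b\<close>. For a support \<open>S\<close> and \<open>i \<in> S\<close>, compare the law
  with support \<open>S\<close> to the one with support \<open>S - {i}\<close>: on \<open>X i \<le> t\<close> the likelihood ratio is at most
  \<open>exp (a * t - a\<^sup>2 / 2)\<close>. Average over all \<open>S\<close> and \<open>i\<close>. Under the law with support \<open>S - {i}\<close> a procedure that
  never selects more than \<open>B * s\<close> coordinates selects a uniformly random coordinate outside that support
  with probability at most \<open>B * s / (n - s + 1)\<close>, so with \<open>t = r - \<delta>\<close> signals below \<open>t\<close> are almost never found,
  while \<open>X i > t\<close> has probability \<open>1 - normal_tail (c + \<delta>)\<close>.
\<close>

section \<open>Unit-variance Gaussian laws and the observation law as their product\<close>

definition gauss :: "real \<Rightarrow> real measure" where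
  "gauss \<mu> = density lborel (normal_density \<mu> 1)"

lemma sets_gauss [simp, measurable_cong]: "sets (gauss \<mu>) = sets borel"
  by (simp add: gauss_def)

lemma space_gauss [simp]: "space (gauss \<mu>) = UNIV"
  by (simp add: gauss_def)

lemma prob_space_gauss: "prob_space (gauss \<mu>)"
  unfolding gauss_def by (rule prob_space_normal_density) simp

text \<open>Slopes 1 and -1 are those that keep the variance equal to 1: they give the translations,
  and the reflection that turns lower tails into upper ones.\<close>

lemma gauss_affine:
  assumes "\<alpha> = 1 \<or> \<alpha> = -1"
  shows "distr (gauss \<mu>) borel (\<lambda>x. \<beta> + \<alpha> * x) = gauss (\<beta> + \<alpha> * \<mu>)"
proof -
  interpret prob_space "gauss \<mu>" by (rule prob_space_gauss)
  have "distributed (gauss \<mu>) lborel (\<lambda>x. x) (normal_density \<mu> 1)"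
    by (auto simp: distributed_def gauss_def intro!: distr_id2)
  from normal_density_affine[OF this, of \<alpha> \<beta>] assms
  have "distr (gauss \<mu>) lborel (\<lambda>x. \<beta> + \<alpha> * x) = gauss (\<beta> + \<alpha> * \<mu>)"
    by (auto simp: distributed_def gauss_def)
  then show ?thesis
    by (simp cong: distr_cong)
qed

lemma measure_gauss_affine:
  assumes "\<alpha> = 1 \<or> \<alpha> = -1" and "A \<in> sets borel"
  shows "measure (gauss (\<beta> + \<alpha> * \<mu>)) A = measure (gauss \<mu>) {x. \<beta> + \<alpha> * x \<in> A}"
  by (subst gauss_affine[symmetric]) (auto simp: measure_distr assms vimage_def)

text \<open>The shift acts on each coordinate separately, so the image measure of a box factorizes.
  The product form gives access to the marginals and to integration over one coordinate at a
  time.\<close>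

lemma obs_law_eq_PiM: "obs_law n \<theta> = (\<Pi>\<^sub>M i\<in>{1..n}. gauss (\<theta> i))"
proof -
  interpret P: product_prob_space "\<lambda>i. gauss (\<theta> i)"
    by (intro product_prob_spaceI prob_space_gauss)
  interpret Q: product_prob_space "\<lambda>i::nat. gauss 0"
    by (intro product_prob_spaceI prob_space_gauss)
  have noise: "noise n = (\<Pi>\<^sub>M i\<in>{1..n}. gauss 0)"
    by (simp add: noise_def gauss_def)
  have meas: "(\<lambda>\<epsilon>. \<lambda>i\<in>{1..n}. \<theta> i + \<epsilon> i) \<in> measurable (noise n) (obs_space n)"
    unfolding obs_space_def noise by measurable
  show ?thesis
  proof (rule P.PiM_eqI)
    show "sets (obs_law n \<theta>) = sets (\<Pi>\<^sub>M i\<in>{1..n}. gauss (\<theta> i))"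
      by (auto simp: obs_law_def obs_space_def intro!: sets_PiM_cong)
    fix A assume A: "\<And>i. i \<in> {1..n} \<Longrightarrow> A i \<in> sets (gauss (\<theta> i))"
    have A': "{x. \<theta> i + x \<in> A i} \<in> sets borel" if "i \<in> {1..n}" for i
      using measurable_sets[of "\<lambda>x. \<theta> i + x" borel borel "A i"] A[OF that]
      by (auto simp: vimage_def)
    have "emeasure (obs_law n \<theta>) (Pi\<^sub>E {1..n} A)
        = emeasure (noise n) ((\<lambda>\<epsilon>. \<lambda>i\<in>{1..n}. \<theta> i + \<epsilon> i) -` (Pi\<^sub>E {1..n} A) \<inter> space (noise n))"
      unfolding obs_law_def using A
      by (intro emeasure_distr meas) (auto simp: obs_space_def intro!: sets_PiM_I_finite)
    also have "(\<lambda>\<epsilon>. \<lambda>i\<in>{1..n}. \<theta> i + \<epsilon> i) -` (Pi\<^sub>E {1..n} A) \<inter> space (noise n)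
        = (\<Pi>\<^sub>E i\<in>{1..n}. {x. \<theta> i + x \<in> A i})"
      by (auto simp: noise space_PiM PiE_iff)
    also have "emeasure (noise n) \<dots> = (\<Prod>i\<in>{1..n}. emeasure (gauss 0) {x. \<theta> i + x \<in> A i})"
      unfolding noise using A' by (intro Q.emeasure_PiM) auto
    also have "\<dots> = (\<Prod>i\<in>{1..n}. emeasure (gauss (\<theta> i)) (A i))"
    proof (intro prod.cong refl)
      fix i assume i: "i \<in> {1..n}"
      have "gauss (\<theta> i) = distr (gauss 0) borel (\<lambda>x. \<theta> i + 1 * x)"
        by (subst gauss_affine) auto
      then show "emeasure (gauss 0) {x. \<theta> i + x \<in> A i} = emeasure (gauss (\<theta> i)) (A i)"
        using A[OF i] by (simp add: emeasure_distr vimage_def)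
    qed
    finally show "emeasure (obs_law n \<theta>) (Pi\<^sub>E {1..n} A)
        = (\<Prod>i\<in>{1..n}. emeasure (gauss (\<theta> i)) (A i))" .
  qed auto
qed

lemma sets_obs_law [simp, measurable_cong]: "sets (obs_law n \<theta>) = sets (obs_space n)"
  by (simp add: obs_law_def)

lemma space_obs_law [simp]: "space (obs_law n \<theta>) = space (obs_space n)"
  by (simp add: obs_law_def)

lemma prob_space_obs_law: "prob_space (obs_law n \<theta>)"
  unfolding obs_law_eq_PiM by (intro prob_space_PiM prob_space_gauss)

lemma measurable_coord [measurable]:
  "i \<in> {1..n} \<Longrightarrow> (\<lambda>X. X i) \<in> borel_measurable (obs_space n)"
  unfolding obs_space_def by measurable

lemma measure_obs_law_coord:
  assumes "i \<in> {1..n}" and "A \<in> sets borel"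
  shows "\<P>(X in obs_law n \<theta>. X i \<in> A) = measure (gauss (\<theta> i)) A"
proof -
  have "distr (obs_law n \<theta>) (gauss (\<theta> i)) (\<lambda>X. X i) = gauss (\<theta> i)"
    unfolding obs_law_eq_PiM using assms(1) by (intro distr_PiM_component prob_space_gauss)
  then have "measure (gauss (\<theta> i)) A = measure (distr (obs_law n \<theta>) (gauss (\<theta> i)) (\<lambda>X. X i)) A"
    by simp
  also have "\<dots> = \<P>(X in obs_law n \<theta>. X i \<in> A)"
    using assms by (subst measure_distr) (auto intro!: arg_cong[where f="measure _"])
  finally show ?thesis by simp
qed

section \<open>Change of measure in one coordinate\<close>

lemma normal_density_tilt:
  "normal_density a 1 y = exp (a * y - a\<^sup>2 / 2) * normal_density 0 1 y"
proof -
  have "- (y - a)\<^sup>2 / 2 = (a * y - a\<^sup>2 / 2) + - y\<^sup>2 / 2"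
    by (simp add: power2_eq_square field_simps)
  then show ?thesis
    by (simp add: normal_density_def exp_add[symmetric] field_simps)
qed

text \<open>Split at \<open>t\<close>. Above \<open>t\<close>, bound \<open>f\<close> by 1; below
  it, the likelihood ratio \<open>exp (a * y - a\<^sup>2 / 2)\<close> is nondecreasing in
  \<open>y\<close> because \<open>0 \<le> a\<close>, hence at most its value at
  \<open>t\<close>.\<close>

lemma nn_integral_gauss_le_tilt:
  fixes f :: "real \<Rightarrow> real"
  assumes [measurable]: "f \<in> borel_measurable borel" and f: "\<And>y. 0 \<le> f y" "\<And>y. f y \<le> 1" and a: "0 \<le> a"
  shows "(\<integral>\<^sup>+y. f y \<partial>gauss a)
    \<le> emeasure (gauss a) {t<..} + exp (a * t - a\<^sup>2 / 2) * (\<integral>\<^sup>+y. f y \<partial>gauss 0)"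
proof -
  let ?L = "exp (a * t - a\<^sup>2 / 2)"
  have "(\<integral>\<^sup>+y. f y \<partial>gauss a) = (\<integral>\<^sup>+y. normal_density a 1 y * f y \<partial>lborel)"
    unfolding gauss_def by (subst nn_integral_density) (auto simp: ennreal_mult')
  also have "\<dots> \<le> (\<integral>\<^sup>+y. normal_density a 1 y * indicator {t<..} y
      + ?L * (normal_density 0 1 y * f y) \<partial>lborel)"
  proof (intro nn_integral_mono ennreal_leI)
    fix y
    show "normal_density a 1 y * f y
        \<le> normal_density a 1 y * indicator {t<..} y + ?L * (normal_density 0 1 y * f y)"
    proof (cases "y > t")
      case True
      have "normal_density a 1 y * f y \<le> normal_density a 1 y * 1"
        using f by (intro mult_left_mono) auto
      moreover have "0 \<le> ?L * (normal_density 0 1 y * f y)"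
        using f by simp
      ultimately show ?thesis using True by simp
    next
      case False
      then have "normal_density a 1 y \<le> ?L * normal_density 0 1 y"
        unfolding normal_density_tilt[of a] using a
        by (intro mult_right_mono) (auto intro!: mult_left_mono)
      from mult_right_mono[OF this f(1)[of y]] False show ?thesis
        by (simp add: mult.assoc)
    qed
  qed
  also have "\<dots> = (\<integral>\<^sup>+y. normal_density a 1 y * indicator {t<..} y \<partial>lborel)
      + ?L * (\<integral>\<^sup>+y. normal_density 0 1 y * f y \<partial>lborel)"
    using f by (simp add: ennreal_plus nn_integral_add nn_integral_cmult ennreal_mult')
  also have "(\<integral>\<^sup>+y. normal_density a 1 y * indicator {t<..} y \<partial>lborel) = emeasure (gauss a) {t<..}"
    unfolding gauss_def by (subst emeasure_density) (auto simp: ennreal_mult' ennreal_indicator)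
  also have "(\<integral>\<^sup>+y. normal_density 0 1 y * f y \<partial>lborel) = (\<integral>\<^sup>+y. f y \<partial>gauss 0)"
    unfolding gauss_def by (subst nn_integral_density) (auto simp: ennreal_mult')
  finally show ?thesis .
qed

lemma normal_tail_eq: "normal_tail x = measure (gauss 0) {x<..}"
  by (simp add: normal_tail_def gauss_def)

lemma measure_gauss_greater: "measure (gauss a) {t<..} = normal_tail (t - a)"
  using measure_gauss_affine[of 1 "{t<..}" a 0]
  by (auto simp: normal_tail_eq intro!: arg_cong[where f="measure _"])

text \<open>The one-dimensional bound is applied to coordinate \<open>i\<close> with all others
  frozen, and the result is integrated over the others.\<close>

lemma integral_obs_law_tilt:
  fixes f :: "(nat \<Rightarrow> real) \<Rightarrow> real"
  assumes f_meas: "f \<in> borel_measurable (obs_space n)"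
    and f: "\<And>X. X \<in> space (obs_space n) \<Longrightarrow> 0 \<le> f X" "\<And>X. X \<in> space (obs_space n) \<Longrightarrow> f X \<le> 1"
    and i: "i \<in> {1..n}" and a: "0 \<le> \<theta> i"
  shows "(\<integral>X. f X \<partial>obs_law n \<theta>)
    \<le> normal_tail (t - \<theta> i) + exp (\<theta> i * t - (\<theta> i)\<^sup>2 / 2) * (\<integral>X. f X \<partial>obs_law n (\<theta>(i := 0)))"
proof -
  define I where "I = {1..n} - {i}"
  define L where "L = exp (\<theta> i * t - (\<theta> i)\<^sup>2 / 2)"
  define R where "R = (\<Pi>\<^sub>M j\<in>I. gauss (\<theta> j))"
  have I: "finite I" "i \<notin> I" "{1..n} = insert i I"
    using i by (auto simp: I_def)
  interpret P: product_prob_space "\<lambda>i. gauss (\<theta> i)"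
    by (intro product_prob_spaceI prob_space_gauss)
  interpret P0: product_prob_space "\<lambda>j. gauss ((\<theta>(i := 0)) j)"
    by (intro product_prob_spaceI prob_space_gauss)
  interpret R: prob_space R
    unfolding R_def by (intro prob_space_PiM prob_space_gauss)
  interpret O1: prob_space "obs_law n \<theta>" by (rule prob_space_obs_law)
  interpret O2: prob_space "obs_law n (\<theta>(i := 0))" by (rule prob_space_obs_law)
  note [measurable] = f_meas
  \<comment> \<open>The two parameters differ only at \<open>i\<close>, so both iterated integrals
    share the outer measure \<open>R\<close>.\<close>
  have R0: "R = (\<Pi>\<^sub>M j\<in>I. gauss ((\<theta>(i := 0)) j))"
    unfolding R_def using I(2) by (intro PiM_cong) auto
  have upd: "x(i := y) \<in> space (obs_space n)" if "x \<in> space R" for x y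
    using that I(2) unfolding obs_space_def R_def I(3) by (auto simp: space_PiM PiE_iff extensional_def)
  have sl: "(\<lambda>y. f (x(i := y))) \<in> borel_measurable borel" if "x \<in> space R" for x
  proof (rule measurable_compose[OF _ f_meas])
    show "(\<lambda>y. x(i := y)) \<in> measurable borel (obs_space n)"
      unfolding obs_space_def
      by (rule measurable_PiM_single')
         (use upd[OF that] in \<open>auto simp: obs_space_def space_PiM fun_upd_def\<close>)
  qed
  have f_law: "(\<lambda>X. ennreal (f X)) \<in> borel_measurable (obs_law n \<theta>')" for \<theta>'
    by measurable
  have fold: "(\<integral>\<^sup>+X. f X \<partial>obs_law n \<theta>) = (\<integral>\<^sup>+x. (\<integral>\<^sup>+y. f (x(i := y)) \<partial>gauss (\<theta> i)) \<partial>R)"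
    unfolding obs_law_eq_PiM I(3) R_def
    by (rule P.product_nn_integral_insert[OF I(1,2)]) (use f_law[of \<theta>] in \<open>simp only: I(3) obs_law_eq_PiM\<close>)
  have fold0: "(\<integral>\<^sup>+X. f X \<partial>obs_law n (\<theta>(i := 0))) = (\<integral>\<^sup>+x. (\<integral>\<^sup>+y. f (x(i := y)) \<partial>gauss 0) \<partial>R)"
    using P0.product_nn_integral_insert[OF I(1,2), of f] f_law[of "\<theta>(i := 0)"]
    unfolding R0 I(3)[symmetric] obs_law_eq_PiM[symmetric] by (simp add: fun_upd_def)
  have "(\<integral>\<^sup>+X. f X \<partial>obs_law n \<theta>)
      \<le> (\<integral>\<^sup>+x. emeasure (gauss (\<theta> i)) {t<..} + L * (\<integral>\<^sup>+y. f (x(i := y)) \<partial>gauss 0) \<partial>R)"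
    unfolding fold L_def using f upd sl a
    by (intro nn_integral_mono nn_integral_gauss_le_tilt) auto
  also have "\<dots> = emeasure (gauss (\<theta> i)) {t<..} + L * (\<integral>\<^sup>+X. f X \<partial>obs_law n (\<theta>(i := 0)))"
  proof -
    interpret G: prob_space "gauss 0" by (rule prob_space_gauss)
    \<comment> \<open>Joint measurability makes the inner integral measurable in \<open>x\<close>,
      which is required to split the outer integral of the sum.\<close>
    have "(\<lambda>(x, y). f (x(i := y))) \<in> borel_measurable (R \<Otimes>\<^sub>M gauss 0)"
    proof -
      have "(\<lambda>z. (fst z)(i := snd z)) \<in> measurable (R \<Otimes>\<^sub>M gauss 0) (obs_space n)"
        unfolding obs_space_def I(3) R_def
      proof (rule measurable_fun_upd[where J=I])
        show "fst \<in> measurable (Pi\<^sub>M I (\<lambda>j. gauss (\<theta> j)) \<Otimes>\<^sub>M gauss 0) (Pi\<^sub>M I (\<lambda>i. borel))"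
          by (simp add: measurable_cong_sets[OF refl sets_PiM_cong[of I I "\<lambda>_. borel" "\<lambda>j. gauss (\<theta> j)"]])
      qed auto
      from measurable_compose[OF this f_meas] show ?thesis
        by (simp add: case_prod_beta')
    qed
    then have "(\<lambda>x. \<integral>\<^sup>+y. f (x(i := y)) \<partial>gauss 0) \<in> borel_measurable R"
      by (intro G.borel_measurable_nn_integral) (simp add: case_prod_beta')
    then show ?thesis
      unfolding fold0 by (simp add: nn_integral_add nn_integral_cmult R.emeasure_space_1)
  qed
  finally have *: "(\<integral>\<^sup>+X. f X \<partial>obs_law n \<theta>)
      \<le> emeasure (gauss (\<theta> i)) {t<..} + L * (\<integral>\<^sup>+X. f X \<partial>obs_law n (\<theta>(i := 0)))" .
  have int: "integrable (obs_law n \<theta>') f" for \<theta>'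
  proof -
    interpret prob_space "obs_law n \<theta>'" by (rule prob_space_obs_law)
    show ?thesis
      using f by (intro integrable_const_bound[where B=1]) auto
  qed
  have nn: "(\<integral>\<^sup>+X. f X \<partial>obs_law n \<theta>') = ennreal (\<integral>X. f X \<partial>obs_law n \<theta>')" for \<theta>'
    using f by (intro nn_integral_eq_integral[OF int]) auto
  have nonneg: "0 \<le> (\<integral>X. f X \<partial>obs_law n \<theta>')" for \<theta>'
    using f by (intro integral_nonneg_AE) auto
  have em: "emeasure (gauss (\<theta> i)) {t<..} = ennreal (normal_tail (t - \<theta> i))"
    using finite_measure.emeasure_eq_measure[OF prob_space.finite_measure[OF prob_space_gauss]]
    by (simp add: measure_gauss_greater)
  have "0 \<le> normal_tail (t - \<theta> i)"
    by (simp add: normal_tail_eq)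
  with * have "ennreal (\<integral>X. f X \<partial>obs_law n \<theta>)
      \<le> ennreal (normal_tail (t - \<theta> i) + L * (\<integral>X. f X \<partial>obs_law n (\<theta>(i := 0))))"
    using nonneg by (simp add: nn em ennreal_mult' ennreal_plus L_def)
  then show ?thesis
    using nonneg \<open>0 \<le> normal_tail (t - \<theta> i)\<close>
    by (subst (asm) ennreal_le_iff) (auto simp: L_def intro!: add_nonneg_nonneg)
qed

subsection \<open>Multiple testing procedures\<close>

lemma procedure_cases:
  assumes "\<phi> \<in> procedures n" "X \<in> space (obs_space n)" "i \<in> {1..n}"
  shows "\<phi> X i = 0 \<or> \<phi> X i = 1"
  using measurable_space[OF assms(1)[unfolded procedures_def] assms(2)] assms(3)
  by (auto simp: space_PiM PiE_iff)

lemma procedure_le_1: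
  assumes "\<phi> \<in> procedures n" "X \<in> space (obs_space n)" "i \<in> {1..n}"
  shows "\<phi> X i \<le> 1"
  using procedure_cases[OF assms] by auto

lemma measurable_procedure:
  assumes "\<phi> \<in> procedures n" "i \<in> {1..n}"
  shows "(\<lambda>X. real (\<phi> X i)) \<in> borel_measurable (obs_space n)"
proof -
  have "(\<lambda>X. \<phi> X i) \<in> measurable (obs_space n) (count_space {0, 1})"
    using measurable_compose[OF assms(1)[unfolded procedures_def] measurable_component_singleton[OF assms(2)]]
    by simp
  from measurable_compose[OF this, of real borel] show ?thesis by simp
qed

lemma measurable_num_selected:
  assumes "\<phi> \<in> procedures n"
  shows "(\<lambda>X. real (\<Sum>i=1..n. \<phi> X i)) \<in> borel_measurable (obs_space n)"
  unfolding of_nat_sum by (intro borel_measurable_sum measurable_procedure assms)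

lemma integrable_unit_obs_law:
  fixes f :: "(nat \<Rightarrow> real) \<Rightarrow> real"
  assumes "f \<in> borel_measurable (obs_space n)"
    and "\<And>X. X \<in> space (obs_space n) \<Longrightarrow> 0 \<le> f X \<and> f X \<le> 1"
  shows "integrable (obs_law n \<theta>) f"
proof -
  interpret prob_space "obs_law n \<theta>" by (rule prob_space_obs_law)
  show ?thesis using assms by (intro integrable_const_bound[where B=1]) auto
qed

lemma integrable_procedure:
  assumes "\<phi> \<in> procedures n" "i \<in> {1..n}"
  shows "integrable (obs_law n \<theta>) (\<lambda>X. real (\<phi> X i))"
  using procedure_le_1[OF assms(1) _ assms(2)]
  by (intro integrable_unit_obs_law measurable_procedure assms) auto

text \<open>The indicator restricts the sum to the support, the maximum with 1 is the support size
  by assumption, and linearity moves the expectation inside.\<close>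

lemma FNR_eq:
  assumes "\<phi> \<in> procedures n" "1 \<le> card (supp n \<theta>)"
  shows "FNR n \<theta> \<phi> = (\<Sum>i\<in>supp n \<theta>. 1 - (\<integral>X. real (\<phi> X i) \<partial>obs_law n \<theta>)) / card (supp n \<theta>)"
proof -
  interpret prob_space "obs_law n \<theta>" by (rule prob_space_obs_law)
  have "FNR n \<theta> \<phi> = (\<integral>X. (\<Sum>i\<in>supp n \<theta>. 1 - real (\<phi> X i)) / card (supp n \<theta>) \<partial>obs_law n \<theta>)"
    unfolding FNR_def using assms(2)
    by (intro Bochner_Integration.integral_cong refl arg_cong2[where f="(/)"])
       (auto simp: supp_def sum.inter_filter intro!: sum.mono_neutral_cong_right)
  also have "\<dots> = (\<Sum>i\<in>supp n \<theta>. 1 - (\<integral>X. real (\<phi> X i) \<partial>obs_law n \<theta>)) / card (supp n \<theta>)"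
    using assms(1) prob_space by (simp add: supp_def integrable_procedure)
  finally show ?thesis .
qed

lemma FNR_bounds:
  assumes "\<phi> \<in> procedures n"
  shows "0 \<le> FNR n \<theta> \<phi>" "FNR n \<theta> \<phi> \<le> 1"
proof -
  interpret prob_space "obs_law n \<theta>" by (rule prob_space_obs_law)
  have E: "0 \<le> (\<integral>X. real (\<phi> X i) \<partial>obs_law n \<theta>)" "(\<integral>X. real (\<phi> X i) \<partial>obs_law n \<theta>) \<le> 1"
    if "i \<in> {1..n}" for i
    using procedure_le_1[OF assms _ that]
    by (auto intro!: integral_le_const integrable_procedure assms that)
  have "0 \<le> FNR n \<theta> \<phi> \<and> FNR n \<theta> \<phi> \<le> 1"
  proof (cases "1 \<le> card (supp n \<theta>)")
    case True
    have "(\<Sum>i\<in>supp n \<theta>. 1 - (\<integral>X. real (\<phi> X i) \<partial>obs_law n \<theta>)) \<le> (\<Sum>i\<in>supp n \<theta>. 1)"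
      using E by (intro sum_mono) (auto simp: supp_def)
    moreover have "0 \<le> (\<Sum>i\<in>supp n \<theta>. 1 - (\<integral>X. real (\<phi> X i) \<partial>obs_law n \<theta>))"
      using E by (intro sum_nonneg) (auto simp: supp_def)
    ultimately show ?thesis
      using True by (auto simp: FNR_eq[OF assms True] divide_le_eq_1)
  next
    case False
    then have "supp n \<theta> = {}"
      by (auto simp: supp_def card_eq_0_iff not_le)
    then have "of_bool (\<theta> i \<noteq> 0) = (0::real)" if "i \<in> {1..n}" for i
      using that by (auto simp: supp_def)
    then have "(\<Sum>i=1..n. of_bool (\<theta> i \<noteq> 0) * (1 - real (\<phi> X i))) = 0" for X
      by (intro sum.neutral) auto
    then show ?thesis
      by (simp add: FNR_def)
  qed
  then show "0 \<le> FNR n \<theta> \<phi>" "FNR n \<theta> \<phi> \<le> 1" by auto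
qed

text \<open>A supremum in \<open>real\<close> dominates its members only for bounded families, so
  each comparison with the worst-case risk goes through this fact.\<close>

lemma bdd_above_FNR: "\<phi> \<in> procedures n \<Longrightarrow> bdd_above ((\<lambda>\<theta>. FNR n \<theta> \<phi>) ` \<Theta>)"
  by (intro bdd_aboveI[of _ 1]) (auto simp: FNR_bounds)

lemma bdd_above_prob_obs_law: "bdd_above ((\<lambda>\<theta>. \<P>(X in obs_law n \<theta>. P X)) ` \<Theta>)"
  by (intro bdd_aboveI[of _ 1]) (auto intro!: prob_space.prob_le_1 prob_space_obs_law)

section \<open>Lower bound for a fixed sample size, by averaging over supports\<close>

text \<open>Removing the marked point is a bijection from pairs of a set and a point in it to pairs
  of a smaller set and a point outside it; inserting the point is the inverse.\<close>

lemma sum_over_subsets_remove: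
  fixes g :: "'a set \<Rightarrow> 'a \<Rightarrow> 'b::comm_monoid_add"
  assumes "finite U"
  shows "(\<Sum>S | S \<subseteq> U \<and> card S = Suc k. \<Sum>i\<in>S. g (S - {i}) i)
       = (\<Sum>S | S \<subseteq> U \<and> card S = k. \<Sum>i\<in>U - S. g S i)"
proof -
  have fin: "finite {S. S \<subseteq> U \<and> card S = m}" for m
    using assms by (auto intro: finite_subset[of _ "Pow U"])
  have fS: "finite S" if "S \<subseteq> U" for S
    using that assms finite_subset by blast
  have "(\<Sum>S | S \<subseteq> U \<and> card S = Suc k. \<Sum>i\<in>S. g (S - {i}) i)
      = (\<Sum>(S, i)\<in>(SIGMA S:{S. S \<subseteq> U \<and> card S = Suc k}. S). g (S - {i}) i)"
    using fin fS by (intro sum.Sigma) auto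
  also have "\<dots> = (\<Sum>(S, i)\<in>(SIGMA S:{S. S \<subseteq> U \<and> card S = k}. U - S). g S i)"
    by (rule sum.reindex_bij_witness[where i="\<lambda>(S, i). (insert i S, i)" and j="\<lambda>(S, i). (S - {i}, i)"])
       (auto simp: fS)
  also have "\<dots> = (\<Sum>S | S \<subseteq> U \<and> card S = k. \<Sum>i\<in>U - S. g S i)"
    using fin assms by (intro sum.Sigma[symmetric]) auto
  finally show ?thesis .
qed

text \<open>The least favourable parameters. The restriction makes them extensional, as membership
  in \<open>signal_class\<close> demands.\<close>

definition spike :: "nat \<Rightarrow> real \<Rightarrow> nat set \<Rightarrow> nat \<Rightarrow> real" where
  "spike n a S = (\<lambda>i\<in>{1..n}. if i \<in> S then a else 0)"

lemma supp_spike: "a \<noteq> 0 \<Longrightarrow> S \<subseteq> {1..n} \<Longrightarrow> supp n (spike n a S) = S"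
  by (auto simp: supp_def spike_def)

lemma spike_remove: "i \<in> {1..n} \<Longrightarrow> (spike n a S)(i := 0) = spike n a (S - {i})"
  by (auto simp: spike_def fun_eq_iff)

text \<open>
  Discarding the selections whenever there are more than \<open>V\<close> of them costs only the probability of that event,
  and makes the number of selections at most \<open>V\<close> under every law. This bound can therefore be used under
  the law with support \<open>S - {i}\<close>, which lies outside the parameter set.
\<close>

lemma sup_FNR_lower_bound:
  fixes \<Theta> :: "(nat \<Rightarrow> real) set" and a t V :: real
  assumes \<phi>: "\<phi> \<in> procedures n" and a: "0 < a" and V: "0 \<le> V" and k: "1 \<le> k" "k \<le> n"
    and spikes: "\<And>S. S \<subseteq> {1..n} \<Longrightarrow> card S = k \<Longrightarrow> spike n a S \<in> \<Theta>"
  shows "1 - (SUP \<theta>\<in>\<Theta>. FNR n \<theta> \<phi>)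
    \<le> (SUP \<theta>\<in>\<Theta>. \<P>(X in obs_law n \<theta>. real (\<Sum>i=1..n. \<phi> X i) > V))
      + normal_tail (t - a) + exp (a * t - a\<^sup>2 / 2) * V / (real n - real k + 1)"
    (is "1 - ?R \<le> ?\<rho> + ?\<tau> + ?L * V / _")
proof -
  obtain m where m: "k = Suc m"
    using k by (cases k) auto
  define bad where "bad X \<longleftrightarrow> real (\<Sum>i=1..n. \<phi> X i) > V" for X
  define \<psi> where "\<psi> X i = real (\<phi> X i) * of_bool (\<not> bad X)" for X i
  define E where "E S i = (\<integral>X. \<psi> X i \<partial>obs_law n (spike n a S))" for S i
  let ?U = "{1..n}"
  have bad_meas [measurable]: "Measurable.pred (obs_space n) bad"
    unfolding bad_def using measurable_num_selected[OF \<phi>] by measurable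
  have \<psi>_meas: "(\<lambda>X. \<psi> X i) \<in> borel_measurable (obs_space n)" if "i \<in> ?U" for i
    unfolding \<psi>_def using measurable_procedure[OF \<phi> that] by measurable
  have \<psi>_01: "0 \<le> \<psi> X i \<and> \<psi> X i \<le> 1" if "X \<in> space (obs_space n)" "i \<in> ?U" for X i
    using procedure_le_1[OF \<phi> that] by (auto simp: \<psi>_def)
  have int: "integrable (obs_law n \<theta>) (\<lambda>X. \<psi> X i)" if "i \<in> ?U" for i \<theta>
    using \<psi>_meas[OF that] \<psi>_01[OF _ that] by (rule integrable_unit_obs_law)
  \<comment> \<open>The truncation error is measured under support \<open>S\<close>, where the
    parameter lies in \<open>\<Theta>\<close> and \<open>?\<rho>\<close> controls it. Only the
    truncated part is moved to support \<open>S - {i}\<close>.\<close>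
  have step: "(\<integral>X. real (\<phi> X i) \<partial>obs_law n (spike n a S)) \<le> ?\<rho> + ?\<tau> + ?L * E (S - {i}) i"
    if S: "S \<subseteq> ?U" "card S = k" and i: "i \<in> S" for S i
  proof -
    let ?P = "obs_law n (spike n a S)"
    have iU: "i \<in> ?U" and si: "spike n a S i = a"
      using S i by (auto simp: spike_def)
    interpret prob_space ?P by (rule prob_space_obs_law)
    have int_bad: "integrable ?P (\<lambda>X. of_bool (bad X) :: real)"
      by (intro integrable_unit_obs_law) auto
    have "(\<integral>X. real (\<phi> X i) \<partial>?P) \<le> (\<integral>X. of_bool (bad X) + \<psi> X i \<partial>?P)"
      using procedure_le_1[OF \<phi> _ iU]
      by (intro integral_mono integrable_procedure \<phi> iU Bochner_Integration.integrable_add int int_bad)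
         (auto simp: \<psi>_def)
    also have "\<dots> = (\<integral>X. of_bool (bad X) \<partial>?P) + (\<integral>X. \<psi> X i \<partial>?P)"
      by (intro Bochner_Integration.integral_add int int_bad iU)
    also have "(\<integral>X. of_bool (bad X) \<partial>?P) = \<P>(X in ?P. bad X)"
    proof -
      have "(\<integral>X. of_bool (bad X) \<partial>?P) = (\<integral>X. indicator {X \<in> space ?P. bad X} X \<partial>?P :: real)"
        by (intro Bochner_Integration.integral_cong) (auto simp: indicator_def)
      then show ?thesis by simp
    qed
    also have "\<P>(X in ?P. bad X) \<le> ?\<rho>"
      unfolding bad_def by (intro cSUP_upper2[OF bdd_above_prob_obs_law spikes[OF S]]) simp
    also have "(\<integral>X. \<psi> X i \<partial>?P) \<le> ?\<tau> + ?L * E (S - {i}) i"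
      using integral_obs_law_tilt[of "\<lambda>X. \<psi> X i" n i "spike n a S" t] \<psi>_meas[OF iU] \<psi>_01[OF _ iU] iU a
      by (simp add: si E_def spike_remove)
    finally show ?thesis by simp
  qed
  \<comment> \<open>The sum runs over the complement of \<open>S\<close> because the removed index
    may be any point outside the smaller support.\<close>
  have sum_E: "(\<Sum>i\<in>?U - S. E S i) \<le> V" for S
  proof -
    let ?P = "obs_law n (spike n a S)"
    interpret prob_space ?P by (rule prob_space_obs_law)
    have "(\<Sum>i\<in>?U - S. E S i) = (\<integral>X. (\<Sum>i\<in>?U - S. \<psi> X i) \<partial>?P)"
      unfolding E_def by (intro Bochner_Integration.integral_sum[symmetric] int) auto
    also have "\<dots> \<le> V"
    proof (intro integral_le_const AE_I2 Bochner_Integration.integrable_sum int)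
      fix X assume "X \<in> space ?P"
      then have "(\<Sum>i\<in>?U - S. \<psi> X i) \<le> (\<Sum>i\<in>?U. \<psi> X i)"
        using \<psi>_01 by (intro sum_mono2) auto
      also have "\<dots> = real (\<Sum>i=1..n. \<phi> X i) * of_bool (\<not> bad X)"
        by (simp add: \<psi>_def sum_distrib_right)
      also have "\<dots> \<le> V" using V by (auto simp: bad_def)
      finally show "(\<Sum>i\<in>?U - S. \<psi> X i) \<le> V" .
    qed auto
    finally show ?thesis .
  qed
  define F where "F j = {S. S \<subseteq> ?U \<and> card S = j}" for j
  have finF: "finite (F j)" for j
    unfolding F_def by (auto intro: finite_subset[of _ "Pow ?U"])
  \<comment> \<open>Multiplication by \<open>k\<close> clears the normalization of the FNR, leaving
    a plain sum of detection probabilities.\<close>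
  have per_S: "k * (1 - ?R) \<le> k * (?\<rho> + ?\<tau>) + ?L * (\<Sum>i\<in>S. E (S - {i}) i)" if "S \<in> F k" for S
  proof -
    have S: "S \<subseteq> ?U" "card S = k" using that by (auto simp: F_def)
    then have su: "supp n (spike n a S) = S"
      using a by (intro supp_spike) auto
    have "FNR n (spike n a S) \<phi> \<le> ?R"
      by (intro cSUP_upper2[OF bdd_above_FNR[OF \<phi>] spikes[OF S]]) simp
    then have "k * (1 - ?R) \<le> k * (1 - FNR n (spike n a S) \<phi>)"
      by (intro mult_left_mono) auto
    also have "\<dots> = (\<Sum>i\<in>S. (\<integral>X. real (\<phi> X i) \<partial>obs_law n (spike n a S)))"
      using k S by (subst FNR_eq[OF \<phi>]) (auto simp: su sum_subtractf field_simps)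
    also have "\<dots> \<le> (\<Sum>i\<in>S. ?\<rho> + ?\<tau> + ?L * E (S - {i}) i)"
      by (intro sum_mono step S)
    also have "\<dots> = k * (?\<rho> + ?\<tau>) + ?L * (\<Sum>i\<in>S. E (S - {i}) i)"
      using S by (simp add: sum.distrib sum_distrib_left sum_distrib_right algebra_simps)
    finally show ?thesis .
  qed
  have "real (card (F k)) * (k * (1 - ?R)) = (\<Sum>S\<in>F k. k * (1 - ?R))"
    by simp
  also have "\<dots> \<le> (\<Sum>S\<in>F k. k * (?\<rho> + ?\<tau>) + ?L * (\<Sum>i\<in>S. E (S - {i}) i))"
    by (intro sum_mono per_S)
  also have "\<dots> = real (card (F k)) * (k * (?\<rho> + ?\<tau>)) + ?L * (\<Sum>S\<in>F k. \<Sum>i\<in>S. E (S - {i}) i)"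
    by (simp add: sum.distrib sum_distrib_left)
  also have "(\<Sum>S\<in>F k. \<Sum>i\<in>S. E (S - {i}) i) = (\<Sum>S\<in>F m. \<Sum>i\<in>?U - S. E S i)"
    unfolding F_def m by (rule sum_over_subsets_remove) simp
  also have "\<dots> \<le> (\<Sum>S\<in>F m. V)"
    by (intro sum_mono sum_E)
  finally have main: "real (card (F k)) * (k * (1 - ?R))
      \<le> real (card (F k)) * (k * (?\<rho> + ?\<tau>)) + ?L * (card (F m) * V)"
    by simp
  \<comment> \<open>The same reindexing with summand 1 relates the sizes of the two families. Since
    \<open>m = k - 1\<close>, the complements have \<open>n - k + 1\<close> points, whence the
    denominator.\<close>
  have "(\<Sum>S\<in>F k. \<Sum>i\<in>S. 1::nat) = (\<Sum>S\<in>F m. \<Sum>i\<in>?U - S. 1)"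
    unfolding F_def m by (rule sum_over_subsets_remove[where g="\<lambda>_ _. 1"]) simp
  also have "(\<Sum>S\<in>F k. \<Sum>i\<in>S. 1::nat) = (\<Sum>S\<in>F k. k)"
    by (intro sum.cong) (auto simp: F_def)
  also have "(\<Sum>S\<in>F m. \<Sum>i\<in>?U - S. 1::nat) = (\<Sum>S\<in>F m. n - m)"
    by (intro sum.cong) (auto simp: F_def card_Diff_subset finite_subset)
  finally have "card (F k) * k = card (F m) * (n - m)"
    by simp
  then have count: "real (card (F k)) * k = real (card (F m)) * (real n - real k + 1)"
    using k m by (metis (no_types, lifting) Suc_leD add_diff_cancel_right' of_nat_Suc of_nat_diff of_nat_mult
      diff_add_eq diff_diff_eq2 add.commute)
  have "F k \<noteq> {}"
    using obtain_subset_with_card_n[of k ?U] k by (auto simp: F_def)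
  then have pos: "real (card (F k)) * k > 0"
    using k finF by (simp add: card_gt_0_iff)
  have npos: "real n - real k + 1 > 0"
    using k by simp
  have "?L * (card (F m) * V) = real (card (F k)) * k * (?L * V / (real n - real k + 1))"
    using npos by (simp add: count)
  with main have "real (card (F k)) * k * (1 - ?R)
      \<le> real (card (F k)) * k * (?\<rho> + ?\<tau> + ?L * V / (real n - real k + 1))"
    by (simp only: distrib_left mult.assoc)
  then show ?thesis
    using pos by (simp only: mult_le_cancel_left_pos)
qed

subsection \<open>Gaussian tails\<close>

lemma real_distribution_gauss: "real_distribution (gauss \<mu>)"
  by (simp add: real_distribution_def real_distribution_axioms_def prob_space_gauss)

lemma normal_tail_eq_cdf: "normal_tail x = 1 - cdf (gauss 0) x"
proof -
  interpret real_distribution "gauss 0" by (rule real_distribution_gauss)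
  have "{x<..} = space (gauss 0) - {..x}" by auto
  then show ?thesis
    using prob_compl[of "{..x}"] by (simp add: normal_tail_eq cdf_def)
qed

lemma tendsto_normal_tail_at_top: "(normal_tail \<longlongrightarrow> 0) at_top"
proof -
  interpret real_distribution "gauss 0" by (rule real_distribution_gauss)
  have "((\<lambda>x. 1 - cdf (gauss 0) x) \<longlongrightarrow> 1 - 1) at_top"
    by (intro tendsto_intros cdf_lim_at_top_prob)
  then show ?thesis by (simp add: normal_tail_eq_cdf[abs_def])
qed

lemma tendsto_normal_tail_at_bot: "(normal_tail \<longlongrightarrow> 1) at_bot"
proof -
  interpret real_distribution "gauss 0" by (rule real_distribution_gauss)
  have "((\<lambda>x. 1 - cdf (gauss 0) x) \<longlongrightarrow> 1 - 0) at_bot"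
    by (intro tendsto_intros cdf_lim_at_bot)
  then show ?thesis by (simp add: normal_tail_eq_cdf[abs_def])
qed

lemma normal_tail_antimono: "x \<le> y \<Longrightarrow> normal_tail y \<le> normal_tail x"
proof -
  interpret real_distribution "gauss 0" by (rule real_distribution_gauss)
  show "x \<le> y \<Longrightarrow> normal_tail y \<le> normal_tail x"
    by (simp add: normal_tail_eq_cdf cdf_nondecreasing)
qed

lemma measure_gauss_less: "measure (gauss a) {..<x} = normal_tail (a - x)"
proof -
  have "{xa. a + - 1 * xa \<in> {a - x<..}} = {..<x}" by auto
  then show ?thesis
    using measure_gauss_affine[of "-1" "{a - x<..}" a a] by (simp add: normal_tail_eq)
qed

text \<open>Reflection yields the open lower half-line, while the complement of the upper tail is
  closed; the endpoint has mass zero.\<close>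

lemma normal_tail_uminus: "normal_tail (- x) = 1 - normal_tail x"
proof -
  interpret real_distribution "gauss 0" by (rule real_distribution_gauss)
  have "emeasure (gauss 0) {x} = 0"
    unfolding gauss_def by (subst emeasure_density) (auto simp: nn_integral_cmult_indicator)
  then have "measure (gauss 0) {..x} = measure (gauss 0) {..<x}"
    using measure_Un_null_set[of "{..<x}" "gauss 0" "{x}"] by (simp add: null_sets_def flip: ivl_disj_un(2))
  then show ?thesis by (simp add: measure_gauss_less normal_tail_eq_cdf[of x] cdf_def)
qed

lemma normal_density_le_1: "normal_density 0 1 x \<le> 1"
proof -
  have "exp (- x\<^sup>2 / 2) \<le> 1" "1 \<le> sqrt (2 * pi)"
    using pi_gt3 by (auto simp: real_le_rsqrt)
  then have "exp (- x\<^sup>2 / 2) \<le> sqrt (2 * pi)"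
    by (rule order_trans)
  then show ?thesis by (simp add: normal_density_def)
qed

text \<open>The density is at most 1, so an interval of length \<open>\<delta>\<close> has mass at
  most \<open>\<delta>\<close>. This absorbs the margin \<open>\<delta>\<close> of the lower bound
  when \<open>b\<close> is constant.\<close>

lemma normal_tail_diff_le:
  assumes "0 \<le> \<delta>"
  shows "normal_tail x - \<delta> \<le> normal_tail (x + \<delta>)"
proof -
  interpret real_distribution "gauss 0" by (rule real_distribution_gauss)
  have "emeasure (gauss 0) {x<..x + \<delta>} \<le> (\<integral>\<^sup>+y. indicator {x<..x + \<delta>} y \<partial>lborel)"
    unfolding gauss_def
    by (subst emeasure_density, simp, simp, intro nn_integral_mono)
       (auto simp: indicator_def normal_density_le_1)
  also have "\<dots> = ennreal \<delta>"
    using assms by simp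
  finally have "measure (gauss 0) {x<..x + \<delta>} \<le> \<delta>"
    using assms by (simp add: emeasure_eq_measure)
  moreover have "normal_tail x = measure (gauss 0) {x<..x + \<delta>} + normal_tail (x + \<delta>)"
    unfolding normal_tail_eq using assms
    by (subst finite_measure_Union[symmetric]) (auto intro!: arg_cong[where f="measure _"])
  ultimately show ?thesis by simp
qed

text \<open>On \<open>x > t\<close> the factor \<open>x / t\<close> exceeds 1, and inserting it
  turns the Gaussian weight into an exact derivative. The constant \<open>1 / sqrt (2 * pi)\<close>
  is bounded by 1.\<close>

lemma normal_tail_mills:
  assumes "0 < t"
  shows "normal_tail t \<le> exp (- t\<^sup>2 / 2) / t"
proof -
  interpret real_distribution "gauss 0" by (rule real_distribution_gauss)
  let ?F = "\<lambda>x. - exp (- x\<^sup>2 / 2) / t"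
  have "emeasure (gauss 0) {t<..}
      = (\<integral>\<^sup>+x. ennreal (normal_density 0 1 x) * indicator {t<..} x \<partial>lborel)"
    unfolding gauss_def by (subst emeasure_density) auto
  also have "\<dots> \<le> (\<integral>\<^sup>+x. ennreal (x / t * exp (- x\<^sup>2 / 2)) * indicator {t..} x \<partial>lborel)"
  proof (intro nn_integral_mono)
    fix x :: real
    have "normal_density 0 1 x \<le> x / t * exp (- x\<^sup>2 / 2)" if "t < x"
    proof -
      have "1 \<le> sqrt (2 * pi)" using pi_gt3 by (simp add: real_le_rsqrt)
      then have "normal_density 0 1 x \<le> 1 * exp (- x\<^sup>2 / 2)"
        by (simp add: normal_density_def divide_le_eq mult_le_cancel_left1)
      also have "\<dots> \<le> x / t * exp (- x\<^sup>2 / 2)"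
        using that assms by (intro mult_right_mono) auto
      finally show ?thesis .
    qed
    then show "ennreal (normal_density 0 1 x) * indicator {t<..} x
        \<le> ennreal (x / t * exp (- x\<^sup>2 / 2)) * indicator {t..} x"
      by (auto simp: indicator_def intro!: ennreal_leI)
  qed
  also have "\<dots> = ennreal (0 - ?F t)"
  proof (rule nn_integral_FTC_atLeast[where F="?F"])
    show "(?F \<longlongrightarrow> 0) at_top" using assms by real_asymp
    show "(?F has_real_derivative x / t * exp (- x\<^sup>2 / 2)) (at x)" for x
      using assms by (auto intro!: derivative_eq_intros simp: field_simps)
  qed (use assms in auto)
  finally show ?thesis
    using assms by (simp add: normal_tail_eq emeasure_eq_measure)
qed

subsection \<open>Asymptotics\<close>

lemma smallo_one_iff_tendsto_0: "f \<in> o[F](\<lambda>_. 1 :: real) \<longleftrightarrow> (f \<longlongrightarrow> 0) F"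
  using smalloI_tendsto[of f "\<lambda>_. 1" F] smalloD_tendsto[of f F "\<lambda>_. 1"] by auto

text \<open>The positive part of \<open>L n - R n\<close> serves as remainder, so it suffices to
  prove the lower bound for each fixed \<open>\<epsilon>\<close>.\<close>

lemma ex_smallo_lower_bound:
  fixes R L :: "nat \<Rightarrow> real"
  assumes "\<And>\<epsilon>. 0 < \<epsilon> \<Longrightarrow> \<forall>\<^sub>F n in sequentially. L n - \<epsilon> \<le> R n"
  shows "\<exists>r. r \<in> o(\<lambda>_. 1) \<and> (\<forall>\<^sub>F n in sequentially. R n \<ge> L n - r n)"
proof (intro exI[of _ "\<lambda>n. max 0 (L n - R n)"] conjI)
  have "(\<lambda>n. max 0 (L n - R n)) \<longlonglongrightarrow> 0"
  proof (rule tendstoI)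
    fix e :: real assume "0 < e"
    then show "\<forall>\<^sub>F n in sequentially. dist (max 0 (L n - R n)) 0 < e"
      using assms[of "e / 2"] by (auto elim!: eventually_mono simp: dist_real_def)
  qed
  then show "(\<lambda>n. max 0 (L n - R n)) \<in> o(\<lambda>_. 1)"
    by (simp add: smallo_one_iff_tendsto_0)
qed (auto intro!: always_eventually)

text \<open>
  With \<open>r = sqrt (2 * ln (n / s))\<close>, \<open>a = r + c\<close> and \<open>t = r - \<delta>\<close> one has
  \<open>exp (a * t - a\<^sup>2 / 2) = (n / s) * exp (- \<delta> * r - c * \<delta> - c\<^sup>2 / 2)\<close>, and the gain \<open>exp (- \<delta> * r)\<close>
  dominates the growth allowed for \<open>B\<close>.
\<close>

lemma eventually_sup_FNR_ge:
  fixes s :: "nat \<Rightarrow> nat" and b B :: "nat \<Rightarrow> real"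
  assumes s: "filterlim s at_top sequentially"
    and ns: "filterlim (\<lambda>n. real n / real (s n)) at_top sequentially"
    and B: "\<forall>\<^sub>F n in sequentially. (B n)\<^sup>2 \<le> exp (ln (real n / real (s n)) powr (1/4))"
    and B1: "\<forall>\<^sub>F n in sequentially. 1 < B n"
    and b: "\<forall>\<^sub>F n in sequentially. b n \<le> c"
    and \<phi>: "\<phi> \<in> sparsity_preserving s B (signal_class s b)"
    and \<delta>: "0 < \<delta>" and \<epsilon>: "0 < \<epsilon>"
  shows "\<forall>\<^sub>F n in sequentially.
    normal_tail (c + \<delta>) - \<epsilon> \<le> (SUP \<theta>\<in>signal_class s b n. FNR n \<theta> (\<phi> n))"
proof -
  define x where "x n = real n / real (s n)" for n
  define \<rho> where "\<rho> n = (SUP \<theta>\<in>signal_class s b n.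
    \<P>(X in obs_law n \<theta>. real (\<Sum>i=1..n. \<phi> n X i) > B n * real (s n)))" for n
  \<comment> \<open>Envelope of the likelihood-ratio term: the last factor is the square root of the
    bound on \<open>(B n)\<^sup>2\<close>, and 2 bounds \<open>n / (n - s + 1)\<close> once
    \<open>n \<ge> 2 * s\<close>.\<close>
  define h where "h y = 2 * (exp (- \<delta> * sqrt (2 * ln y) - c * \<delta> - c\<^sup>2 / 2) * exp (ln y powr (1/4) / 2))"
    for y :: real
  have x: "filterlim x at_top sequentially"
    using ns by (simp add: x_def[abs_def])
  have proc: "\<phi> n \<in> procedures n" for n
    using \<phi> by (simp add: sparsity_preserving_def)
  have "\<rho> \<longlonglongrightarrow> 0"
    using \<phi> by (simp add: sparsity_preserving_def smallo_one_iff_tendsto_0 \<rho>_def[abs_def])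
  then have ev\<rho>: "\<forall>\<^sub>F n in sequentially. \<rho> n < \<epsilon> / 2"
    using \<epsilon> by (intro order_tendstoD) auto
  have "(h \<longlongrightarrow> 0) at_top"
    unfolding h_def using \<delta> by real_asymp
  then have "(\<lambda>n. h (x n)) \<longlonglongrightarrow> 0"
    using x by (rule filterlim_compose)
  then have evh: "\<forall>\<^sub>F n in sequentially. h (x n) < \<epsilon> / 2"
    using \<epsilon> by (intro order_tendstoD) auto
  have "filterlim (\<lambda>n. sqrt (2 * ln (x n)) + c) at_top sequentially"
    by (rule filterlim_compose[OF _ x]) real_asymp
  \<comment> \<open>The constant \<open>c\<close> may be negative, so positivity of the signal level
    holds only eventually.\<close>
  then have eva: "\<forall>\<^sub>F n in sequentially. 0 < sqrt (2 * ln (x n)) + c"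
    by (simp add: filterlim_at_top_dense)
  have evx: "\<forall>\<^sub>F n in sequentially. 2 \<le> x n"
    using x by (simp add: filterlim_at_top)
  have evs: "\<forall>\<^sub>F n in sequentially. 1 \<le> s n"
    using s by (simp add: filterlim_at_top)
  show ?thesis
    using ev\<rho> evh eva evx evs B B1 b
  proof eventually_elim
    case (elim n)
    define r where "r = sqrt (2 * ln (x n))"
    define a where "a = r + c"
    define t where "t = r - \<delta>"
    let ?L = "exp (a * t - a\<^sup>2 / 2)"
    let ?R = "SUP \<theta>\<in>signal_class s b n. FNR n \<theta> (\<phi> n)"
    have a: "0 < a" using elim by (simp add: a_def r_def)
    have sn: "2 * real (s n) \<le> real n"
      using elim by (simp add: x_def field_simps)
    have r2: "r\<^sup>2 = 2 * ln (x n)"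
      using elim by (simp add: r_def)
    have B2: "B n \<le> exp (ln (x n) powr (1/4) / 2)"
    proof (rule power2_le_imp_le)
      show "(B n)\<^sup>2 \<le> (exp (ln (x n) powr (1/4) / 2))\<^sup>2"
        using elim by (simp add: x_def exp_double[symmetric])
    qed simp
    have "1 - ?R \<le> \<rho> n + normal_tail (t - a) + ?L * (B n * real (s n)) / (real n - real (s n) + 1)"
      unfolding \<rho>_def
    proof (rule sup_FNR_lower_bound[OF proc a])
      \<comment> \<open>The level \<open>r + c\<close> meets the requirement \<open>r + b n\<close>
        because \<open>b n \<le> c\<close>.\<close>
      fix S assume "S \<subseteq> {1..n}" "card S = s n"
      then show "spike n a S \<in> signal_class s b n"
        using a supp_spike[of a S n] elim
        by (auto simp: signal_class_def spike_def a_def r_def x_def)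
    qed (use elim sn in auto)
    also have "t - a = - (c + \<delta>)"
      by (simp add: t_def a_def)
    also have "normal_tail \<dots> = 1 - normal_tail (c + \<delta>)"
      by (rule normal_tail_uminus)
    also have "?L * (B n * real (s n)) / (real n - real (s n) + 1) \<le> h (x n)"
    proof -
      have "a * t - a\<^sup>2 / 2 = r\<^sup>2 / 2 + (- \<delta> * r - c * \<delta> - c\<^sup>2 / 2)"
        by (simp add: a_def t_def power2_eq_square field_simps)
      then have L: "?L = x n * exp (- \<delta> * r - c * \<delta> - c\<^sup>2 / 2)"
        using elim r2 by (simp add: exp_add)
      have "x n * real (s n) = real n"
        using elim by (simp add: x_def)
      then have "?L * (B n * real (s n)) / (real n - real (s n) + 1)
          = (exp (- \<delta> * r - c * \<delta> - c\<^sup>2 / 2) * B n) * (real n / (real n - real (s n) + 1))"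
        unfolding L by (simp add: field_simps)
      also have "\<dots> \<le> (exp (- \<delta> * r - c * \<delta> - c\<^sup>2 / 2) * exp (ln (x n) powr (1/4) / 2)) * 2"
        using elim sn B2 by (intro mult_mono mult_left_mono) (auto simp: divide_le_eq)
      also have "\<dots> = h (x n)"
        by (simp add: h_def r_def)
      finally show ?thesis .
    qed
    finally show ?case
      using elim by simp
  qed
qed

section \<open>The threshold test: missed signals and number of selections\<close>

definition threshold_test :: "nat \<Rightarrow> real \<Rightarrow> (nat \<Rightarrow> real) \<Rightarrow> nat \<Rightarrow> nat" where
  "threshold_test n r X = (\<lambda>i\<in>{1..n}. if r < \<bar>X i\<bar> then 1 else 0)"

lemma threshold_test_procedure: "threshold_test n r \<in> procedures n"
proof -
  have "(\<lambda>X. if r < \<bar>X i\<bar> then 1 else 0) \<in> measurable (obs_space n) (count_space {0, 1 :: nat})"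
    if "i \<in> {1..n}" for i
    using measurable_coord[OF that] by (intro measurable_If) auto
  then show ?thesis
    unfolding procedures_def threshold_test_def[abs_def] by (rule measurable_restrict)
qed

lemma integral_threshold_test:
  assumes "i \<in> {1..n}"
  shows "(\<integral>X. real (threshold_test n r X i) \<partial>obs_law n \<theta>) = measure (gauss (\<theta> i)) {x. r < \<bar>x\<bar>}"
proof -
  interpret prob_space "obs_law n \<theta>" by (rule prob_space_obs_law)
  have "(\<integral>X. real (threshold_test n r X i) \<partial>obs_law n \<theta>)
      = (\<integral>X. indicator {X \<in> space (obs_law n \<theta>). X i \<in> {x. r < \<bar>x\<bar>}} X \<partial>obs_law n \<theta>)"
    using assms by (intro Bochner_Integration.integral_cong) (auto simp: threshold_test_def)
  also have "\<dots> = \<P>(X in obs_law n \<theta>. X i \<in> {x. r < \<bar>x\<bar>})"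
    by (simp add: Int_absorb2)
  also have "\<dots> = measure (gauss (\<theta> i)) {x. r < \<bar>x\<bar>}"
    using assms by (intro measure_obs_law_coord) measurable
  finally show ?thesis .
qed

text \<open>Only the tail on the side of the sign of \<open>a\<close> is kept; the mean lies at
  least \<open>c\<close> beyond the threshold on that side.\<close>

lemma measure_gauss_abs_greater_ge:
  assumes "r + c \<le> \<bar>a\<bar>"
  shows "1 - normal_tail c \<le> measure (gauss a) {x. r < \<bar>x\<bar>}"
proof -
  interpret real_distribution "gauss a" by (rule real_distribution_gauss)
  have "1 - normal_tail c = normal_tail (- c)" by (simp add: normal_tail_uminus)
  also have "\<dots> \<le> measure (gauss a) {x. r < \<bar>x\<bar>}"
  proof (cases "0 \<le> a")
    case True
    with assms have "normal_tail (- c) \<le> measure (gauss a) {r<..}"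
      unfolding measure_gauss_greater by (intro normal_tail_antimono) auto
    also have "\<dots> \<le> measure (gauss a) {x. r < \<bar>x\<bar>}"
      by (intro finite_measure_mono) auto
    finally show ?thesis .
  next
    case False
    with assms have "normal_tail (- c) \<le> measure (gauss a) {..<- r}"
      unfolding measure_gauss_less by (intro normal_tail_antimono) auto
    also have "\<dots> \<le> measure (gauss a) {x. r < \<bar>x\<bar>}"
      by (intro finite_measure_mono) auto
    finally show ?thesis .
  qed
  finally show ?thesis .
qed

lemma measure_gauss_0_abs_greater: "measure (gauss 0) {x. r < \<bar>x\<bar>} \<le> 2 * normal_tail r"
proof -
  interpret real_distribution "gauss 0" by (rule real_distribution_gauss)
  have "{x. r < \<bar>x\<bar>} = {r<..} \<union> {..<- r}" by auto
  then have "measure (gauss 0) {x. r < \<bar>x\<bar>} \<le> measure (gauss 0) {r<..} + measure (gauss 0) {..<- r}"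
    by (simp add: measure_Un_le)
  then show ?thesis by (simp add: measure_gauss_greater measure_gauss_less)
qed

lemma FNR_threshold_test_le:
  assumes "1 \<le> card (supp n \<theta>)" and "\<And>i. i \<in> supp n \<theta> \<Longrightarrow> r + c \<le> \<bar>\<theta> i\<bar>"
  shows "FNR n \<theta> (threshold_test n r) \<le> normal_tail c"
proof -
  have "(\<Sum>i\<in>supp n \<theta>. 1 - (\<integral>X. real (threshold_test n r X i) \<partial>obs_law n \<theta>))
      \<le> (\<Sum>i\<in>supp n \<theta>. normal_tail c)"
  proof (intro sum_mono)
    fix i assume i: "i \<in> supp n \<theta>"
    then have "i \<in> {1..n}" by (simp add: supp_def)
    with measure_gauss_abs_greater_ge[OF assms(2)[OF i]]
    show "1 - (\<integral>X. real (threshold_test n r X i) \<partial>obs_law n \<theta>) \<le> normal_tail c"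
      by (simp add: integral_threshold_test)
  qed
  then show ?thesis
    using assms(1) by (simp add: FNR_eq[OF threshold_test_procedure] divide_le_eq mult.commute)
qed

text \<open>The support accounts for at most \<open>k\<close> selections, so more than
  \<open>B * k\<close> of them force at least \<open>\<eta> * k\<close> false ones. Markov's
  inequality and the two-sided tail bound then apply.\<close>

lemma prob_threshold_test_exceeds:
  assumes k: "1 \<le> k" and "card (supp n \<theta>) = k" and \<eta>: "0 < \<eta>" "1 + \<eta> \<le> B"
  shows "\<P>(X in obs_law n \<theta>. real (\<Sum>i=1..n. threshold_test n r X i) > B * real k)
    \<le> 2 * real n * normal_tail r / (\<eta> * real k)"
proof -
  interpret prob_space "obs_law n \<theta>" by (rule prob_space_obs_law)
  let ?\<phi> = "threshold_test n r"
  define N where "N = {1..n} - supp n \<theta>"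
  have S: "supp n \<theta> \<subseteq> {1..n}" and N: "N \<subseteq> {1..n}"
    by (auto simp: supp_def N_def)
  note int = integrable_procedure[OF threshold_test_procedure]
  have int_N: "integrable (obs_law n \<theta>) (\<lambda>X. \<Sum>i\<in>N. real (?\<phi> X i))"
    using N by (intro Bochner_Integration.integrable_sum int) auto
  have "\<P>(X in obs_law n \<theta>. real (\<Sum>i=1..n. ?\<phi> X i) > B * real k)
      \<le> \<P>(X in obs_law n \<theta>. \<eta> * real k \<le> (\<Sum>i\<in>N. real (?\<phi> X i)))"
  proof (intro finite_measure_mono)
    show "{X \<in> space (obs_law n \<theta>). \<eta> * real k \<le> (\<Sum>i\<in>N. real (?\<phi> X i))} \<in> events"
      using borel_measurable_integrable[OF int_N] by measurable
    show "{X \<in> space (obs_law n \<theta>). real (\<Sum>i=1..n. ?\<phi> X i) > B * real k}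
        \<subseteq> {X \<in> space (obs_law n \<theta>). \<eta> * real k \<le> (\<Sum>i\<in>N. real (?\<phi> X i))}"
    proof safe
      fix X assume X: "X \<in> space (obs_law n \<theta>)" and B: "real (\<Sum>i=1..n. ?\<phi> X i) > B * real k"
      have "(\<Sum>i\<in>supp n \<theta>. real (?\<phi> X i)) \<le> (\<Sum>i\<in>supp n \<theta>. 1)"
        using S by (intro sum_mono) (auto simp: threshold_test_def)
      then have "(\<Sum>i\<in>supp n \<theta>. real (?\<phi> X i)) \<le> real k"
        using assms by simp
      moreover have "real (\<Sum>i=1..n. ?\<phi> X i) = (\<Sum>i\<in>N. real (?\<phi> X i)) + (\<Sum>i\<in>supp n \<theta>. real (?\<phi> X i))"
        unfolding of_nat_sum N_def using S by (intro sum.subset_diff) auto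
      moreover have "(1 + \<eta>) * real k \<le> B * real k"
        using \<eta> by (intro mult_right_mono) auto
      ultimately show "\<eta> * real k \<le> (\<Sum>i\<in>N. real (?\<phi> X i))"
        using B by (simp add: algebra_simps)
    qed
  qed
  also have "\<dots> \<le> (\<integral>X. (\<Sum>i\<in>N. real (?\<phi> X i)) \<partial>obs_law n \<theta>) / (\<eta> * real k)"
    using int_N \<eta> k by (intro integral_Markov_inequality_measure[where A="{}"]) (auto intro!: sum_nonneg)
  also have "(\<integral>X. (\<Sum>i\<in>N. real (?\<phi> X i)) \<partial>obs_law n \<theta>) = (\<Sum>i\<in>N. measure (gauss (\<theta> i)) {x. r < \<bar>x\<bar>})"
    using N by (subst Bochner_Integration.integral_sum) (auto intro!: int sum.cong integral_threshold_test)
  also have "\<dots> \<le> (\<Sum>i\<in>N. 2 * normal_tail r)"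
    using measure_gauss_0_abs_greater by (intro sum_mono) (auto simp: N_def supp_def)
  also have "\<dots> \<le> real n * (2 * normal_tail r)"
    using card_mono[OF _ N] by (auto intro!: mult_right_mono simp: normal_tail_eq)
  finally show ?thesis
    using \<eta> k by (simp add: divide_right_mono mult_ac)
qed

lemma signal_class_nonempty:
  assumes "s n \<le> n"
  shows "signal_class s b n \<noteq> {}"
proof -
  obtain S where S: "S \<subseteq> {1..n}" "card S = s n"
    using obtain_subset_with_card_n[of "s n" "{1..n}"] assms by auto
  \<comment> \<open>The absolute value plus 1 makes the level nonzero and above the threshold
    whatever the sign of the latter.\<close>
  let ?a = "\<bar>sqrt (2 * ln (real n / real (s n))) + b n\<bar> + 1"
  have "spike n ?a S \<in> signal_class s b n"
    using S supp_spike[of ?a S n] by (auto simp: signal_class_def spike_def)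
  then show ?thesis by blast
qed

section \<open>Combination of both bounds in the three regimes of \<open>b\<close>\<close>

theorem theorem3:
  fixes s :: "nat \<Rightarrow> nat" and b B :: "nat \<Rightarrow> real"
  assumes "filterlim s at_top sequentially"
    and "filterlim (\<lambda>n. real n / real (s n)) at_top sequentially"
    and "(\<exists>c. \<forall>n. b n = c) \<or> filterlim b at_top sequentially \<or> filterlim b at_bot sequentially"
    and "\<forall>\<^sub>F n in sequentially. (B n)\<^sup>2 \<le> exp (ln (real n / real (s n)) powr (1/4))"
    and "liminf (\<lambda>n. ereal (B n)) > 1"
  shows "inf_eq_up_to_o1 (sparsity_preserving s B (signal_class s b))
           (\<lambda>n \<phi>. SUP \<theta>\<in>signal_class s b n. FNR n \<theta> \<phi>)
           (\<lambda>n. normal_tail (b n))"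
proof -
  define x where "x n = real n / real (s n)" for n
  define r where "r n = sqrt (2 * ln (x n))" for n
  define T where "T n = threshold_test n (r n)" for n
  obtain \<eta> where \<eta>: "0 < \<eta>" and B\<eta>: "\<forall>\<^sub>F n in sequentially. 1 + \<eta> \<le> B n"
  proof -
    \<comment> \<open>A real strictly between 1 and the limit inferior gives a fixed slack
      \<open>\<eta> = y - 1\<close>, independent of \<open>n\<close>.\<close>
    obtain y where y: "1 < ereal y" "ereal y < liminf (\<lambda>n. ereal (B n))"
      using ereal_dense2[OF assms(5)] by auto
    have "\<forall>\<^sub>F n in sequentially. ereal y < ereal (B n)"
      using y(2) by (rule less_LiminfD)
    then show ?thesis
      using y(1) by (intro that[of "y - 1"]) (auto elim!: eventually_mono)
  qed
  then have B1: "\<forall>\<^sub>F n in sequentially. 1 < B n"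
    by (auto elim!: eventually_mono)
  have x: "filterlim x at_top sequentially"
    using assms(2) by (simp add: x_def[abs_def])
  have evx: "\<forall>\<^sub>F n in sequentially. 2 \<le> x n"
    using x by (simp add: filterlim_at_top)
  have evs: "\<forall>\<^sub>F n in sequentially. 1 \<le> s n"
    using assms(1) by (simp add: filterlim_at_top)
  have evne: "\<forall>\<^sub>F n in sequentially. signal_class s b n \<noteq> {}"
    using evx evs by eventually_elim (auto intro!: signal_class_nonempty simp: x_def field_simps)
  have r: "filterlim r at_top sequentially"
    unfolding r_def by (rule filterlim_compose[OF _ x]) real_asymp
  have "(\<lambda>n. SUP \<theta>\<in>signal_class s b n.
      \<P>(X in obs_law n \<theta>. real (\<Sum>i=1..n. T n X i) > B n * real (s n))) \<longlonglongrightarrow> 0"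
  proof (rule tendsto_sandwich[OF _ _ tendsto_const])
    show "\<forall>\<^sub>F n in sequentially. (SUP \<theta>\<in>signal_class s b n.
        \<P>(X in obs_law n \<theta>. real (\<Sum>i=1..n. T n X i) > B n * real (s n))) \<le> 2 / (\<eta> * r n)"
      using evx evs evne B\<eta>
    proof eventually_elim
      case (elim n)
      have r0: "0 < r n" and r2: "(r n)\<^sup>2 = 2 * ln (x n)"
        using elim by (auto simp: r_def)
      have "2 * real n * normal_tail (r n) / (\<eta> * real (s n))
          \<le> 2 * real n * (exp (- (r n)\<^sup>2 / 2) / r n) / (\<eta> * real (s n))"
        using \<eta> r0 by (intro divide_right_mono mult_left_mono normal_tail_mills) auto
      \<comment> \<open>The threshold is calibrated so that this factor \<open>s / n\<close> cancels
        \<open>n / s\<close>; only \<open>1 / r n\<close> remains and tends to 0.\<close>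
      also have "exp (- (r n)\<^sup>2 / 2) = 1 / x n"
        using elim by (simp add: r2 exp_minus inverse_eq_divide)
      also have "2 * real n * (1 / x n / r n) / (\<eta> * real (s n)) = 2 / (\<eta> * r n)"
        using elim r0 by (cases "n = 0") (auto simp: x_def field_simps)
      finally have "2 * real n * normal_tail (r n) / (\<eta> * real (s n)) \<le> 2 / (\<eta> * r n)" .
      then show ?case
        unfolding T_def using elim \<eta>
        by (intro cSUP_least order_trans[OF prob_threshold_test_exceeds]) (auto simp: signal_class_def)
    qed
    show "\<forall>\<^sub>F n in sequentially. 0 \<le> (SUP \<theta>\<in>signal_class s b n.
        \<P>(X in obs_law n \<theta>. real (\<Sum>i=1..n. T n X i) > B n * real (s n)))"
      using evne
    proof eventually_elim
      case (elim n)
      then obtain \<theta> where "\<theta> \<in> signal_class s b n" by blast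
      then show ?case
        by (rule cSUP_upper2[OF bdd_above_prob_obs_law]) simp
    qed
    have "((\<lambda>y. 2 / (\<eta> * y)) \<longlongrightarrow> 0) at_top"
      using \<eta> by real_asymp
    then show "(\<lambda>n. 2 / (\<eta> * r n)) \<longlonglongrightarrow> 0"
      using r by (rule filterlim_compose)
  qed
  then have T: "T \<in> sparsity_preserving s B (signal_class s b)"
    by (simp add: sparsity_preserving_def smallo_one_iff_tendsto_0 T_def threshold_test_procedure)
  \<comment> \<open>This bound has no error term and is uniform in \<open>b\<close>, so all three
    regimes share it with remainder 0.\<close>
  have upper: "\<forall>\<^sub>F n in sequentially. (SUP \<theta>\<in>signal_class s b n. FNR n \<theta> (T n)) \<le> normal_tail (b n)"
    using evs evne
    by eventually_elim
       (auto intro!: cSUP_least FNR_threshold_test_le simp: T_def r_def x_def signal_class_def)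
  have lower: "\<forall>\<^sub>F n in sequentially.
      normal_tail (b n) - \<epsilon> \<le> (SUP \<theta>\<in>signal_class s b n. FNR n \<theta> (\<phi> n))"
    if \<phi>: "\<phi> \<in> sparsity_preserving s B (signal_class s b)" and \<epsilon>: "0 < \<epsilon>" for \<phi> \<epsilon>
  proof -
    note ge = eventually_sup_FNR_ge[OF assms(1,2,4) B1 _ \<phi>]
    consider (const) c where "\<And>n. b n = c" | (top) "filterlim b at_top sequentially"
      | (bot) "filterlim b at_bot sequentially"
      using assms(3) by blast
    then show ?thesis
    proof cases
      case const
      \<comment> \<open>Half of \<open>\<epsilon>\<close> is spent as the margin
        \<open>\<delta>\<close>, the other half as the additive error.\<close>
      have "\<forall>\<^sub>F n in sequentially.
          normal_tail (c + \<epsilon> / 2) - \<epsilon> / 2 \<le> (SUP \<theta>\<in>signal_class s b n. FNR n \<theta> (\<phi> n))"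
        using \<epsilon> by (intro ge) (auto simp: const)
      then show ?thesis
        using normal_tail_diff_le[of "\<epsilon> / 2" c] \<epsilon> by (auto elim!: eventually_mono simp: const)
    next
      case top
      \<comment> \<open>Here the target itself vanishes, so nonnegativity of the FNR
        suffices.\<close>
      have "(\<lambda>n. normal_tail (b n)) \<longlonglongrightarrow> 0"
        using tendsto_normal_tail_at_top top by (rule filterlim_compose)
      then have "\<forall>\<^sub>F n in sequentially. normal_tail (b n) < \<epsilon>"
        using \<epsilon> by (intro order_tendstoD) auto
      then show ?thesis
        using evne
      proof eventually_elim
        case (elim n)
        have proc: "\<phi> n \<in> procedures n"
          using \<phi> by (simp add: sparsity_preserving_def)
        obtain \<theta> where "\<theta> \<in> signal_class s b n" using elim by blast
        then have "0 \<le> (SUP \<theta>\<in>signal_class s b n. FNR n \<theta> (\<phi> n))"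
          by (rule cSUP_upper2[OF bdd_above_FNR[OF proc]]) (rule FNR_bounds(1)[OF proc])
        then show ?case using elim by simp
      qed
    next
      case bot
      have "\<forall>\<^sub>F c in at_bot. 1 - \<epsilon> / 2 < normal_tail c"
        using tendsto_normal_tail_at_bot \<epsilon> by (intro order_tendstoD) auto
      then obtain c where c: "1 - \<epsilon> / 2 < normal_tail c"
        by (auto dest: eventually_happens)
      \<comment> \<open>Eventually \<open>b n \<le> c - 1\<close>; with that bound and
        \<open>\<delta> = 1\<close> the tail is evaluated exactly at \<open>c\<close>, where it
        exceeds \<open>1 - \<epsilon> / 2\<close>.\<close>
      have "\<forall>\<^sub>F n in sequentially.
          normal_tail (c - 1 + 1) - \<epsilon> / 2 \<le> (SUP \<theta>\<in>signal_class s b n. FNR n \<theta> (\<phi> n))"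
        using \<epsilon> bot by (intro ge) (auto simp: filterlim_at_bot)
      moreover have "normal_tail y \<le> 1" for y
        unfolding normal_tail_eq by (intro prob_space.prob_le_1 prob_space_gauss)
      ultimately show ?thesis
        using c by (elim eventually_mono) (smt (verit) field_sum_of_halves)
    qed
  qed
  show ?thesis
    unfolding inf_eq_up_to_o1_def
  proof (intro conjI ballI bexI[OF _ T])
    show "\<exists>r. r \<in> o(\<lambda>_. 1) \<and> (\<forall>\<^sub>F n in sequentially.
        normal_tail (b n) - r n \<le> (SUP \<theta>\<in>signal_class s b n. FNR n \<theta> (\<phi> n)))"
      if "\<phi> \<in> sparsity_preserving s B (signal_class s b)" for \<phi>
      using lower[OF that] by (rule ex_smallo_lower_bound)
    show "\<exists>r. r \<in> o(\<lambda>_. 1) \<and> (\<forall>\<^sub>F n in sequentially.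
        (SUP \<theta>\<in>signal_class s b n. FNR n \<theta> (T n)) \<le> normal_tail (b n) + r n)"
      using upper by (intro exI[of _ "\<lambda>_. 0"]) simp
  qed
qed

end
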